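(* If $f\in\mathcal{S}^*_{Ne}$, then $f\in\Omega$ in the disc $|z|<r_0$, i.e. $|zf'(z)-f(z)|<\frac12$ for all $|z|<r_0$, where $r_0\approx0.524752$ is the positive root of $$2r\left(r+\frac{r^3}{3}\right)\exp\left(r-\frac{r^3}{9}\right)-1=0.$$
   Context: $\mathbb{D}=\{z\in\mathbb{C}:|z|<1\}$. $\mathcal{A}$ is the class of analytic functions $f$ on $\mathbb{D}$ with $f(0)=0$, $f'(0)=1$. $\Omega=\{f\in\mathcal{A}:|zf'(z)-f(z)|<\frac12,\ z\in\mathbb{D}\}$; "$f\in\Omega$ in the disc $|z|<r_0$" means that the defining inequality holds for all $|z|<r_0$. $\mathcal{S}^*_{Ne}$ is the class of $f\in\mathcal{A}$ with $zf'(z)/f(z)\prec 1+z-z^3/3$, where $p\prec\phi$ means $p=\phi\circ\omega$ for some analytic $\omega:\mathbb{D}\to\mathbb{D}$ with $\omega(0)=0$. The root is taken in $(0,1)$. *)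

theory Defs
  imports "HOL-Complex_Analysis.Complex_Analysis"
begin

definition class_A :: "(complex \<Rightarrow> complex) set" where
  "class_A = {f. f holomorphic_on ball 0 1 \<and> f 0 = 0 \<and> deriv f 0 = 1}"

definition subordinate :: "(complex \<Rightarrow> complex) \<Rightarrow> (complex \<Rightarrow> complex) \<Rightarrow> bool" where
  "subordinate p \<phi> \<longleftrightarrow>
     (\<exists>\<omega>. \<omega> holomorphic_on ball 0 1 \<and> \<omega> ` ball 0 1 \<subseteq> ball 0 1 \<and> \<omega> 0 = 0 \<and>
          (\<forall>z\<in>ball 0 1. p z = \<phi> (\<omega> z)))"

text \<open>The quotient z f'(z) / f(z) has a removable singularity at the origin for f in
  class A, with limit 1 there; in HOL the literal quotient would be 0/0 = 0.\<close>

definition log_deriv_quot :: "(complex \<Rightarrow> complex) \<Rightarrow> complex \<Rightarrow> complex" where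
  "log_deriv_quot f z = (if z = 0 then 1 else z * deriv f z / f z)"

definition phi_Ne :: "complex \<Rightarrow> complex" where
  "phi_Ne z = 1 + z - z ^ 3 / 3"

text \<open>The condition f z \<noteq> 0 for z \<noteq> 0 states that the quotient z f'(z) / f(z) is defined
  throughout the punctured disc; it has to be explicit since x / 0 = 0 in HOL.\<close>

definition starlike_Ne :: "(complex \<Rightarrow> complex) set" where
  "starlike_Ne = {f \<in> class_A. (\<forall>z\<in>ball 0 1 - {0}. f z \<noteq> 0) \<and>
                               subordinate (log_deriv_quot f) phi_Ne}"

text \<open>f is in Omega in the disc |z| < r; the class Omega itself is the case r = 1.\<close>

definition Omega_in_disc :: "real \<Rightarrow> (complex \<Rightarrow> complex) set" where
  "Omega_in_disc r = {f \<in> class_A. \<forall>z\<in>ball 0 r. norm (z * deriv f z - f z) < 1 / 2}"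

end

theory Submission
  imports Defs
begin

text \<open>Writing \<open>f z = z exp (h z)\<close>, the subordination says \<open>z h' z = w - w\<^sup>3/3\<close> with
  \<open>w = \<omega> z\<close>, and \<open>z f' z - f z = z exp (h z) (w - w\<^sup>3/3)\<close>. By the Schwarz lemma
  \<open>|w| \<le> |z|\<close>, which bounds the last factor by \<open>|z| + |z|\<^sup>3/3\<close>. On the disc \<open>|w| \<le> s\<close> the
  real part of \<open>w - w\<^sup>3/3\<close> is largest at \<open>w = s\<close> as long as \<open>s \<le> 1/\<surd>3\<close>, so integrating
  \<open>Re (w - w\<^sup>3/3) / |z|\<close> along a ray gives \<open>Re (h z) \<le> r - r\<^sup>3/9\<close> for \<open>r = |z| \<le> 1/\<surd>3\<close>.
  The root \<open>r0\<close> lies below \<open>1/\<surd>3 = 0.577...\<close>.\<close>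

text \<open>The Lagrange remainder \<open>exp t / fact n * x ^ n\<close> is nonnegative in both
  cases. This reduces the numerical estimates of the root to rational arithmetic.\<close>

lemma exp_ge_Taylor:
  fixes x :: real
  assumes "0 \<le> x \<or> even n"
  shows "(\<Sum>m<n. x ^ m / fact m) \<le> exp x"
proof -
  obtain t where "exp x = (\<Sum>m<n. x ^ m / fact m) + exp t / fact n * x ^ n"
    using Maclaurin_exp_le by blast
  moreover have "0 \<le> x ^ n"
    using assms by (auto simp: zero_le_even_power)
  ultimately show ?thesis
    by simp
qed

text \<open>The left side of the root equation without its -1, so the root is where it takes the
  value 1. It arises as twice the bound for \<open>norm (z * deriv f z - f z)\<close> at
  \<open>norm z = r\<close>.\<close>

definition bound_Ne :: "real \<Rightarrow> real" where
  "bound_Ne r = 2 * r * (r + r ^ 3 / 3) * exp (r - r ^ 3 / 9)"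

text \<open>The polynomial factor increases strictly. The exponent does not decrease, because the
  cofactor of \<open>s - r\<close> in \<open>s ^ 3 - r ^ 3\<close> stays below 9 on the unit
  interval.\<close>

lemma bound_Ne_strict_mono:
  assumes "0 \<le> r" "r < s" "s \<le> 1"
  shows "bound_Ne r < bound_Ne s"
proof -
  have "s\<^sup>2 \<le> 1" "r\<^sup>2 \<le> 1" "r * s \<le> 1"
    using assms by (auto simp: power_le_one mult_le_one)
  then have "(s - r) * (s\<^sup>2 + s * r + r\<^sup>2) \<le> (s - r) * 9"
    using assms by (intro mult_left_mono) (auto simp: mult.commute)
  then have "s ^ 3 - r ^ 3 \<le> 9 * (s - r)"
    by (simp add: power2_eq_square power3_eq_cube algebra_simps)
  then have "exp (r - r ^ 3 / 9) \<le> exp (s - s ^ 3 / 9)"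
    by simp
  moreover have "r ^ 3 < s ^ 3"
    using assms by (intro power_strict_mono) auto
  then have "2 * r * (r + r ^ 3 / 3) < 2 * s * (s + s ^ 3 / 3)"
    using assms by (intro mult_strict_mono[where a = "2 * r"]) auto
  ultimately show ?thesis
    using assms unfolding bound_Ne_def by (intro mult_less_le_imp_less[where c = "exp _"]) auto
qed

text \<open>An upper bound for \<open>exp x\<close> is needed, so \<open>c * exp x < 1\<close> is
  rewritten as \<open>c < exp (- x)\<close>. A Taylor sum at the negative point \<open>- x\<close>
  is a lower bound when its number of terms is even, here 8.\<close>

lemma bound_Ne_less_1: "bound_Ne (5247515 / 10 ^ 7) < 1"
proof -
  define x :: real where "x = 5247515 / 10 ^ 7 - (5247515 / 10 ^ 7) ^ 3 / 9"
  define c :: real where "c = 2 * (5247515 / 10 ^ 7) * (5247515 / 10 ^ 7 + (5247515 / 10 ^ 7) ^ 3 / 3)"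
  have "c < (\<Sum>m<8. (- x) ^ m / fact m)"
    by (simp add: c_def x_def eval_nat_numeral(2,3) fact_numeral)
  also have "\<dots> \<le> exp (- x)"
    by (intro exp_ge_Taylor) simp
  finally have "c * exp x < exp (- x) * exp x"
    by simp
  then show ?thesis
    by (simp add: bound_Ne_def c_def x_def flip: exp_add)
qed

lemma bound_Ne_greater_1: "1 < bound_Ne (5247525 / 10 ^ 7)"
proof -
  define x :: real where "x = 5247525 / 10 ^ 7 - (5247525 / 10 ^ 7) ^ 3 / 9"
  define c :: real where "c = 2 * (5247525 / 10 ^ 7) * (5247525 / 10 ^ 7 + (5247525 / 10 ^ 7) ^ 3 / 3)"
  have "0 \<le> x" "0 \<le> c"
    by (simp_all add: x_def c_def power3_eq_cube)
  have "1 < c * (\<Sum>m<7. x ^ m / fact m)"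
    by (simp add: c_def x_def eval_nat_numeral(2,3) fact_numeral)
  also have "\<dots> \<le> c * exp x"
    using \<open>0 \<le> x\<close> \<open>0 \<le> c\<close> by (intro mult_left_mono exp_ge_Taylor) auto
  finally show ?thesis
    by (simp add: bound_Ne_def c_def x_def)
qed

text \<open>The end points are 0.524752 minus and plus \<open>5 / 10 ^ 7\<close>; the intermediate
  value theorem applies between them.\<close>

lemma bound_Ne_root:
  obtains r0 where "5247515 / 10 ^ 7 < r0" "r0 < 5247525 / 10 ^ 7" "bound_Ne r0 = 1"
proof -
  have "continuous_on {5247515 / 10 ^ 7..5247525 / 10 ^ 7} bound_Ne"
    unfolding bound_Ne_def by (intro continuous_intros) auto
  then obtain r where "5247515 / 10 ^ 7 \<le> r" "r \<le> 5247525 / 10 ^ 7" "bound_Ne r = 1"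
    using IVT'[of bound_Ne "5247515 / 10 ^ 7" 1 "5247525 / 10 ^ 7"]
      bound_Ne_less_1 bound_Ne_greater_1 by auto
  moreover from this have "r \<noteq> 5247515 / 10 ^ 7" "r \<noteq> 5247525 / 10 ^ 7"
    using bound_Ne_less_1 bound_Ne_greater_1 by (metis less_irrefl)+
  ultimately show ?thesis
    using that[of r] by linarith
qed

text \<open>On the circle of radius \<rho> the gap between the values at \<rho> and at
  \<open>w\<close> factors as \<open>(\<rho> - x) * (1 - (\<rho> + 2 * x)\<^sup>2 / 3)\<close>. The
  second factor is nonnegative since \<open>\<bar>\<rho> + 2 * x\<bar> \<le> 3 * \<rho>\<close> and
  \<open>3 * \<rho>\<^sup>2 \<le> 1\<close>.\<close>

lemma Re_cubic_le:
  fixes w :: complex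
  assumes "norm w \<le> s" "3 * s\<^sup>2 \<le> 1"
  shows "Re (w - w ^ 3 / 3) \<le> s - s ^ 3 / 3"
proof -
  define x y \<rho> where "x = Re w" and "y = Im w" and "\<rho> = norm w"
  have \<rho>2: "\<rho>\<^sup>2 = x\<^sup>2 + y\<^sup>2"
    by (simp add: \<rho>_def x_def y_def cmod_power2)
  have \<rho>: "0 \<le> \<rho>" "\<rho> \<le> s" "\<bar>x\<bar> \<le> \<rho>"
    using assms abs_Re_le_cmod by (auto simp: \<rho>_def x_def)
  have "\<rho>\<^sup>2 \<le> s\<^sup>2"
    using \<rho> by (intro power_mono) auto
  have "(\<rho> + 2 * x)\<^sup>2 \<le> (3 * \<rho>)\<^sup>2"
    using \<rho> by (intro power2_le_iff_abs_le[THEN iffD2]) auto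
  also have "\<dots> \<le> 3"
    using \<open>\<rho>\<^sup>2 \<le> s\<^sup>2\<close> assms by (simp add: power_mult_distrib)
  finally have "0 \<le> (\<rho> - x) * (1 - (\<rho> + 2 * x)\<^sup>2 / 3)"
    using \<rho> by (intro mult_nonneg_nonneg) auto
  also have "\<dots> = (\<rho> - \<rho> ^ 3 / 3) - (x - (4 * x ^ 3 - 3 * x * \<rho>\<^sup>2) / 3)"
    by (simp add: field_simps power2_eq_square power3_eq_cube)
  also have "4 * x ^ 3 - 3 * x * \<rho>\<^sup>2 = Re (w ^ 3)"
    unfolding \<rho>2 by (simp add: x_def y_def power3_eq_cube power2_eq_square algebra_simps)
  finally have 1: "Re (w - w ^ 3 / 3) \<le> \<rho> - \<rho> ^ 3 / 3"
    by (simp add: x_def)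
  \<comment> \<open>It remains to pass from radius \<rho> to \<open>s\<close>, by monotonicity of
    \<open>t - t ^ 3 / 3\<close>.\<close>
  have "\<rho> * s \<le> s\<^sup>2"
    using \<rho> by (simp add: power2_eq_square mult_right_mono)
  then have "s\<^sup>2 + s * \<rho> + \<rho>\<^sup>2 \<le> 3"
    using \<open>\<rho>\<^sup>2 \<le> s\<^sup>2\<close> assms(2) by (subst mult.commute) linarith
  then have "(s - \<rho>) * (s\<^sup>2 + s * \<rho> + \<rho>\<^sup>2) \<le> (s - \<rho>) * 3"
    using \<rho> by (intro mult_left_mono) auto
  then have "\<rho> - \<rho> ^ 3 / 3 \<le> s - s ^ 3 / 3"
    by (simp add: field_simps power2_eq_square power3_eq_cube)
  with 1 show ?thesis
    by linarith
qed

text \<open>The quotient \<open>f z / z\<close>, extended by \<open>deriv f 0\<close> at the origin,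
  is holomorphic and has no zeros, so it has a holomorphic logarithm on the disc. That logarithm is
  fixed only up to multiples of 2 pi i, hence \<open>exp (h 0) = 1\<close> rather than
  \<open>h 0 = 0\<close>.\<close>

lemma class_A_eq_id_times_exp:
  assumes "f \<in> class_A" "\<And>z. z \<in> ball 0 1 - {0} \<Longrightarrow> f z \<noteq> 0"
  obtains h where "h holomorphic_on ball 0 1" "exp (h 0) = 1"
    "\<And>z. z \<in> ball 0 1 \<Longrightarrow> f z = z * exp (h z)"
proof -
  have f: "f holomorphic_on ball 0 1" "f 0 = 0" "deriv f 0 = 1"
    using assms(1) by (auto simp: class_A_def)
  define g where "g = (\<lambda>z. if z = 0 then deriv f 0 else (f z - f 0) / (z - 0))"
  have "g holomorphic_on ball 0 1"
    unfolding g_def by (rule pole_lemma_open) (use f in auto)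
  moreover have "g z \<noteq> 0" if "z \<in> ball 0 1" for z
    using that assms(2)[of z] f by (auto simp: g_def)
  ultimately obtain h where h: "h holomorphic_on ball 0 1"
    "\<And>z. z \<in> ball 0 1 \<Longrightarrow> g z = exp (h z)"
    using contractible_imp_holomorphic_log[of g "ball 0 1"]
    by (metis convex_ball convex_imp_contractible)
  show ?thesis
  proof (rule that[OF h(1)])
    show "exp (h 0) = 1"
      using h(2)[of 0] f by (simp add: g_def)
    show "f z = z * exp (h z)" if "z \<in> ball 0 1" for z
      using h(2)[OF that] f by (auto simp: g_def field_simps split: if_splits)
  qed
qed

text \<open>Along the ray through \<open>z\<close> the function \<open>Re h - q\<close> has
  nonpositive derivative, by \<open>le\<close> divided by \<open>t\<close>. This replaces an
  integral by a monotonicity argument.\<close>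

lemma Re_le_by_radial_derivative:
  fixes h :: "complex \<Rightarrow> complex" and q q' :: "real \<Rightarrow> real"
  assumes h: "h holomorphic_on ball 0 R" and "norm z < R"
    and q: "\<And>t. (q has_real_derivative q' t) (at t)"
    and le: "\<And>w. 0 < norm w \<Longrightarrow> norm w < norm z \<Longrightarrow> Re (w * deriv h w) \<le> norm w * q' (norm w)"
  shows "Re (h z) - Re (h 0) \<le> q (norm z) - q 0"
proof (cases "z = 0")
  case False
  define u where "u = sgn z"
  have u: "norm u = 1" "z = of_real (norm z) * u"
    using False by (simp_all add: u_def norm_sgn) (simp add: complex_sgn_def scaleR_conv_of_real)
  have dh: "(h has_field_derivative deriv h w) (at w)" if "norm w < R" for w
    using that h by (intro holomorphic_derivI[of h "ball 0 R"]) auto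
  have norm_tu: "norm (of_real t * u) = t" if "0 \<le> t" for t
    using that u(1) by (simp add: norm_mult)
  have D: "((\<lambda>t. Re (h (of_real t * u)) - q t) has_real_derivative
      Re (deriv h (of_real t * u) * u) - q' t) (at t)" if "0 \<le> t" "t \<le> norm z" for t
  proof -
    have "((\<lambda>t. of_real t * u) has_vector_derivative u) (at t)"
      by (auto intro!: derivative_eq_intros)
    from field_vector_diff_chain_at[OF this dh] that norm_tu \<open>norm z < R\<close>
    have "((\<lambda>t. h (of_real t * u)) has_vector_derivative deriv h (of_real t * u) * u) (at t)"
      by (simp add: o_def mult.commute)
    then show ?thesis
      by (intro derivative_intros q)
  qed
  have "Re (h (of_real (norm z) * u)) - q (norm z) \<le> Re (h (of_real 0 * u)) - q 0"
  \<comment> \<open>The sign of the derivative is needed only for \<open>0 < t < norm z\<close>,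
    which matches the range of \<open>le\<close>; the end points require continuity alone.\<close>
  proof (rule DERIV_nonpos_imp_decreasing_open[where f = "\<lambda>t. Re (h (of_real t * u)) - q t"])
    fix t assume t: "0 < t" "t < norm z"
    then have "Re (of_real t * u * deriv h (of_real t * u)) \<le> t * q' t"
      using le[of "of_real t * u"] norm_tu[of t] by simp
    moreover have "Re (of_real t * u * deriv h (of_real t * u)) = t * Re (deriv h (of_real t * u) * u)"
      by (simp add: algebra_simps)
    ultimately have "Re (deriv h (of_real t * u) * u) - q' t \<le> 0"
      using t by simp
    then show "\<exists>y. ((\<lambda>t. Re (h (of_real t * u)) - q t) has_real_derivative y) (at t) \<and> y \<le> 0"
      using D[of t] t by auto
  next
    show "continuous_on {0..norm z} (\<lambda>t. Re (h (of_real t * u)) - q t)"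
      by (intro continuous_at_imp_continuous_on ballI DERIV_isCont[OF D]) auto
  qed simp
  then show ?thesis
    using u(2) by simp
qed simp

lemma starlike_Ne_norm_le:
  assumes "f \<in> starlike_Ne" "norm z < 1" "3 * (norm z)\<^sup>2 \<le> 1"
  shows "2 * norm (z * deriv f z - f z) \<le> bound_Ne (norm z)"
proof (cases "z = 0")
  case True
  then show ?thesis
    using assms(1) by (simp add: starlike_Ne_def class_A_def bound_Ne_def)
next
  case False
  have "f \<in> class_A" and nz: "\<And>z. z \<in> ball 0 1 - {0} \<Longrightarrow> f z \<noteq> 0"
    using assms(1) by (auto simp: starlike_Ne_def)
  then obtain h where h: "h holomorphic_on ball 0 1" "exp (h 0) = 1"
    and fh: "\<And>z. z \<in> ball 0 1 \<Longrightarrow> f z = z * exp (h z)"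
    using class_A_eq_id_times_exp by blast
  obtain \<omega> where \<omega>: "\<omega> holomorphic_on ball 0 1" "\<omega> ` ball 0 1 \<subseteq> ball 0 1" "\<omega> 0 = 0"
    and eq: "\<And>z. z \<in> ball 0 1 \<Longrightarrow> log_deriv_quot f z = phi_Ne (\<omega> z)"
    using assms(1) by (auto simp: starlike_Ne_def subordinate_def)
  have \<omega>_le: "norm (\<omega> w) \<le> norm w" if "norm w < 1" for w
    by (rule Schwarz_Lemma(1)) (use \<omega> that in \<open>auto simp: image_subset_iff\<close>)
  have df: "deriv f w = exp (h w) + w * (exp (h w) * deriv h w)" if "norm w < 1" for w
  proof -
    have "((\<lambda>w. w * exp (h w)) has_field_derivative exp (h w) + w * (exp (h w) * deriv h w)) (at w)"
      by (rule derivative_eq_intros holomorphic_derivI[OF h(1)] refl)+ (use that in auto)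
    moreover have "eventually (\<lambda>w. w \<in> ball 0 1) (nhds w)"
      using that by (intro eventually_nhds_in_open) auto
    then have "eventually (\<lambda>w. f w = w * exp (h w)) (nhds w)"
      by eventually_elim (use fh in auto)
    ultimately show ?thesis
      by (simp add: DERIV_imp_deriv deriv_cong_ev)
  qed
  \<comment> \<open>The logarithmic derivative of \<open>w * exp (h w)\<close>, times
    \<open>w\<close>, is \<open>1 + w * deriv h w\<close>; the 1 cancels against that of
    \<open>phi_Ne\<close>.\<close>
  have dh: "w * deriv h w = \<omega> w - \<omega> w ^ 3 / 3" if "norm w < 1" "w \<noteq> 0" for w
  proof -
    have "1 + w * deriv h w = log_deriv_quot f w"
      using that by (simp add: log_deriv_quot_def df fh field_simps)
    with eq[of w] that show ?thesis
      by (simp add: phi_Ne_def)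
  qed
  have "norm (\<omega> z - \<omega> z ^ 3 / 3) \<le> norm (\<omega> z) + norm (\<omega> z) ^ 3 / 3"
    by (rule order_trans[OF norm_triangle_ineq4]) (simp add: norm_divide norm_power)
  also have "\<dots> \<le> norm z + norm z ^ 3 / 3"
    using \<omega>_le assms by (intro add_mono divide_right_mono power_mono) auto
  finally have *: "norm (z * deriv h z) \<le> norm z + norm z ^ 3 / 3"
    using dh assms False by simp
  \<comment> \<open>Here \<open>t - t ^ 3 / 9\<close> is the antiderivative of
    \<open>(t - t ^ 3 / 3) / t\<close>.\<close>
  have "Re (h z) - Re (h 0) \<le> (norm z - norm z ^ 3 / 9) - (0 - 0 ^ 3 / 9)"
  proof (rule Re_le_by_radial_derivative[OF h(1), where q' = "\<lambda>t. 1 - t\<^sup>2 / 3"])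
    show "((\<lambda>t. t - t ^ 3 / 9) has_real_derivative 1 - t\<^sup>2 / 3) (at t)" for t :: real
      by (auto intro!: derivative_eq_intros simp: power2_eq_square)
    fix w :: complex assume w: "0 < norm w" "norm w < norm z"
    then have "(norm w)\<^sup>2 \<le> (norm z)\<^sup>2"
      by (intro power_mono) auto
    then have "Re (\<omega> w - \<omega> w ^ 3 / 3) \<le> norm w - norm w ^ 3 / 3"
      using w assms by (intro Re_cubic_le \<omega>_le) linarith+
    then show "Re (w * deriv h w) \<le> norm w * (1 - (norm w)\<^sup>2 / 3)"
      using dh[of w] w assms by (simp add: right_diff_distrib power2_eq_square power3_eq_cube)
  qed (use assms in auto)
  moreover have "Re (h 0) = 0"
    using h(2) norm_exp_eq_Re[of "h 0"] by simp
  ultimately have "norm (exp (h z)) \<le> exp (norm z - norm z ^ 3 / 9)"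
    by simp
  then have "norm z * norm (exp (h z)) * norm (z * deriv h z)
      \<le> norm z * exp (norm z - norm z ^ 3 / 9) * (norm z + norm z ^ 3 / 3)"
    using * by (intro mult_mono mult_nonneg_nonneg) auto
  moreover have "z * deriv f z - f z = z * exp (h z) * (z * deriv h z)"
    using assms by (simp add: df fh algebra_simps)
  then have "norm (z * deriv f z - f z) = norm z * norm (exp (h z)) * norm (z * deriv h z)"
    by (simp only: norm_mult)
  moreover have "bound_Ne (norm z) =
      2 * (norm z * exp (norm z - norm z ^ 3 / 9) * (norm z + norm z ^ 3 / 3))"
    by (simp only: bound_Ne_def mult_ac)
  ultimately show ?thesis
    by linarith
qed

theorem theorem2p20:
  shows "\<exists>r0::real.
    0 < r0 \<and> r0 < 1 \<and>
    (\<forall>r::real. 0 < r \<and> r < 1 \<longrightarrow>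
      (2 * r * (r + r ^ 3 / 3) * exp (r - r ^ 3 / 9) - 1 = 0 \<longleftrightarrow> r = r0)) \<and>
    \<bar>r0 - 0.524752\<bar> \<le> 5 / 10 ^ 7 \<and>
    (\<forall>f\<in>starlike_Ne. f \<in> Omega_in_disc r0)"
proof -
  obtain r0 where r0: "5247515 / 10 ^ 7 < r0" "r0 < 5247525 / 10 ^ 7" "bound_Ne r0 = 1"
    by (rule bound_Ne_root)
  have unique: "bound_Ne r = 1 \<longleftrightarrow> r = r0" if "0 < r" "r < 1" for r
    using bound_Ne_strict_mono[of r r0] bound_Ne_strict_mono[of r0 r] r0 that
    by (cases r r0 rule: linorder_cases) auto
  have "norm (z * deriv f z - f z) < 1 / 2" if "f \<in> starlike_Ne" "norm z < r0" for f z
  proof -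
    \<comment> \<open>The upper end of the bracket lies below \<open>1 / sqrt 3\<close>, so the
      whole disc of radius \<open>r0\<close> is within reach of the cubic estimate.\<close>
    have "(norm z)\<^sup>2 \<le> (5247525 / 10 ^ 7)\<^sup>2"
      using that r0 by (intro power_mono) auto
    then have "3 * (norm z)\<^sup>2 \<le> 1"
      by (simp add: power2_eq_square)
    then have "2 * norm (z * deriv f z - f z) \<le> bound_Ne (norm z)"
      using that r0 by (intro starlike_Ne_norm_le) auto
    also have "\<dots> < 1"
      using bound_Ne_strict_mono[of "norm z" r0] that r0 by auto
    finally show ?thesis
      by simp
  qed
  then have "\<forall>f\<in>starlike_Ne. f \<in> Omega_in_disc r0"
    by (auto simp: Omega_in_disc_def starlike_Ne_def)
  moreover have "\<bar>r0 - 0.524752\<bar> \<le> 5 / 10 ^ 7"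
    using r0 unfolding abs_le_iff by simp
  ultimately show ?thesis
    using r0 unique by (intro exI[of _ r0]) (auto simp: bound_Ne_def)
qed

end
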